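(* Let $g$, $q_d$, $\alpha$, $\beta$ be as defined in the context (associated with a real polynomial $p$, an interval $[a,b]$ with $-1<a<b<1$, and a degree $d$). Define $\|f\|_{L_\infty(\phi_1,\phi_2)}=\sup_{\phi\in(\phi_1,\phi_2)}|f(\phi)|$ and $$\Delta_\alpha=\min\{\alpha-\beta,\,2\pi-2\alpha\},\qquad \Delta_\beta=\min\{\alpha-\beta,\,2\beta\}.$$ Then for every $d\ge2$, $$|q_d(\alpha)-g(\alpha)|\le\frac{3\pi^6\,\|g\|_{L_\infty(0,\pi)}}{4\,\Delta_\alpha^4\,(d+2)^3}+\frac{\pi^2\,\|g'\|_{L_\infty(\beta,\alpha)}}{4(d+2)},$$ $$|q_d(\beta)-g(\beta)|\le\frac{3\pi^6\,\|g\|_{L_\infty(0,\pi)}}{4\,\Delta_\beta^4\,(d+2)^3}+\frac{\pi^2\,\|g'\|_{L_\infty(\beta,\alpha)}}{4(d+2)}.$$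
   Context: Let $-1<a<b<1$, let $M\ge 1$ be an integer, let $p\in\mathcal P_{M-1}$ (real polynomials of degree at most $M-1$), and let $d$ be a positive integer. Let $h(t)=1$ for $t\in(a,b)$, $h(t)=\frac12$ for $t\in\{a,b\}$, $h(t)=0$ for $t\in[-1,1]\setminus[a,b]$, and $\tilde h(t)=p(t)h(t)$. $T_j$ is the Chebyshev polynomial of the first kind of degree $j$. The Chebyshev--Jackson expansion of degree $d$ is $$F_d(p)(t)=\frac{c_0}{2}+\sum_{j=1}^d\rho_{j,d}\,c_j\,T_j(t),\qquad c_j=\frac2\pi\int_a^b\frac{p(t)T_j(t)}{\sqrt{1-t^2}}\,dt,$$ with Jackson damping factors $$\rho_{j,d}=\frac{\sin((j+1)\alpha_d)}{(d+2)\sin(\alpha_d)}+\Bigl(1-\frac{j+1}{d+2}\Bigr)\cos(j\alpha_d),\qquad \alpha_d=\frac{\pi}{d+2}.$$ Put $\alpha=\arccos(a)$, $\beta=\arccos(b)$, so $0<\beta<\alpha<\pi$. The $2\pi$-periodic function $g$ is $g(\theta)=\tilde h(\cos\theta)$, i.e. on $[-\pi,\pi]$: $g(\theta)=p(\cos\theta)$ for $\theta\in(-\alpha,-\beta)\cup(\beta,\alpha)$, $g(\theta)=\frac12p(\cos\theta)$ for $\theta\in\{\pm\alpha,\pm\beta\}$, and $g(\theta)=0$ otherwise. (On $(\beta,\alpha)$, $g(\theta)=p(\cos\theta)$ is smooth, and $g'$ is its derivative there.) Finally $$q_d(\theta)=F_d(p)(\cos\theta)=\frac{c_0}{2}+\sum_{j=1}^d\rho_{j,d}c_j\cos(j\theta).$$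 *)

theory Defs
  imports "HOL-Analysis.Analysis" "HOL-Computational_Algebra.Polynomial"
begin

fun cheb_poly :: "nat \<Rightarrow> real poly" where
  "cheb_poly 0 = 1"
| "cheb_poly (Suc 0) = [:0, 1:]"
| "cheb_poly (Suc (Suc n)) = [:0, 2:] * cheb_poly (Suc n) - cheb_poly n"

lemma poly_cheb_poly_cos: "poly (cheb_poly n) (cos \<theta>) = cos (real n * \<theta>)"
proof (induction n rule: cheb_poly.induct)
  case (3 n)
  have "cos (real (Suc (Suc n)) * \<theta>) + cos (real n * \<theta>) = 2 * cos \<theta> * cos (real (Suc n) * \<theta>)"
    using cos_add[of "real (Suc n) * \<theta>" \<theta>] cos_diff[of "real (Suc n) * \<theta>" \<theta>]
    by (simp add: algebra_simps)
  then show ?case using 3 by (simp add: algebra_simps)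
qed simp_all

definition window :: "real \<Rightarrow> real \<Rightarrow> real \<Rightarrow> real" where
  "window a b t = (if a < t \<and> t < b then 1 else if t = a \<or> t = b then 1/2 else 0)"

definition windowed_poly :: "real \<Rightarrow> real \<Rightarrow> real poly \<Rightarrow> real \<Rightarrow> real" where
  "windowed_poly a b p t = poly p t * window a b t"

definition cheb_coeff :: "real \<Rightarrow> real \<Rightarrow> real poly \<Rightarrow> nat \<Rightarrow> real" where
  "cheb_coeff a b p j =
     2 / pi * integral {a..b} (\<lambda>t. poly p t * poly (cheb_poly j) t / sqrt (1 - t\<^sup>2))"

definition jackson_angle :: "nat \<Rightarrow> real" where
  "jackson_angle d = pi / (real d + 2)"

definition jackson_damping :: "nat \<Rightarrow> nat \<Rightarrow> real" where
  "jackson_damping j d =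
     sin ((real j + 1) * jackson_angle d) / ((real d + 2) * sin (jackson_angle d))
     + (1 - (real j + 1) / (real d + 2)) * cos (real j * jackson_angle d)"

definition cheb_jackson :: "real \<Rightarrow> real \<Rightarrow> nat \<Rightarrow> real poly \<Rightarrow> real \<Rightarrow> real" where
  "cheb_jackson a b d p t =
     cheb_coeff a b p 0 / 2
     + (\<Sum>j = 1..d. jackson_damping j d * cheb_coeff a b p j * poly (cheb_poly j) t)"

definition g_fun :: "real \<Rightarrow> real \<Rightarrow> real poly \<Rightarrow> real \<Rightarrow> real" where
  "g_fun a b p \<theta> = windowed_poly a b p (cos \<theta>)"

definition q_fun :: "real \<Rightarrow> real \<Rightarrow> nat \<Rightarrow> real poly \<Rightarrow> real \<Rightarrow> real" where
  "q_fun a b d p \<theta> = cheb_jackson a b d p (cos \<theta>)"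

lemma q_fun_eq:
  "q_fun a b d p \<theta> = cheb_coeff a b p 0 / 2
     + (\<Sum>j = 1..d. jackson_damping j d * cheb_coeff a b p j * cos (real j * \<theta>))"
  by (simp add: q_fun_def cheb_jackson_def poly_cheb_poly_cos)

text \<open>A plain supremum, not an essential one. It is taken in the reals, so it is meaningful only
  for \<open>l < u\<close> and \<open>f\<close> bounded on the interval.\<close>

definition sup_norm :: "real \<Rightarrow> real \<Rightarrow> (real \<Rightarrow> real) \<Rightarrow> real" where
  "sup_norm l u f = (SUP x\<in>{l<..<u}. \<bar>f x\<bar>)"

definition Delta_\<alpha> :: "real \<Rightarrow> real \<Rightarrow> real" where
  "Delta_\<alpha> \<alpha> \<beta> = min (\<alpha> - \<beta>) (2 * pi - 2 * \<alpha>)"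

definition Delta_\<beta> :: "real \<Rightarrow> real \<Rightarrow> real" where
  "Delta_\<beta> \<alpha> \<beta> = min (\<alpha> - \<beta>) (2 * \<beta>)"

end

theory Submission
  imports Defs
begin

text \<open>
  The Jackson kernel \<open>K\<close> is a nonnegative trigonometric polynomial of mass \<open>\<pi>/2\<close> on \<open>[0, \<pi>]\<close>, because
  its coefficients are the normalised autocorrelations of \<open>sin ((k + 1) \<pi> / (d + 2))\<close>. Orthogonality
  turns its moments against \<open>sin\<^sup>2 (u/2)\<close> and the fourth power of \<open>sin (u/2)\<close> into expressions in the
  first two coefficients, and \<open>u \<le> \<pi> sin (u/2)\<close> turns these into bounds on the first moment of \<open>K\<close>
  and on its mass at distance at least \<open>\<delta>\<close> from \<open>0\<close>.
  With \<open>f \<theta> = p (cos \<theta>)\<close>, \<open>\<pi> q (c)\<close> is the integral of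
  \<open>f \<theta> (K (\<theta> - c) + K (\<theta> + c))\<close> over \<open>[\<beta>, \<alpha>]\<close>. At an endpoint \<open>c\<close> of that interval the first
  summand sees half of the mass of \<open>K\<close>, up to a tail, which explains the value \<open>f c / 2\<close>; replacing
  \<open>f \<theta>\<close> by \<open>f c\<close> costs the derivative term, and the tail (once) and the mirrored summand
  (twice) cost three far masses.
\<close>

section \<open>Damping factors: closed forms and autocorrelation\<close>

lemma sin_jackson_angle_pos: "sin (jackson_angle d) > 0"
  unfolding jackson_angle_def by (rule sin_gt_zero) (auto simp: field_simps add_pos_nonneg)

lemma jackson_damping_mult:
  "(real d + 2) * jackson_damping j d
    = sin ((real j + 1) * jackson_angle d) / sin (jackson_angle d)
      + (real d + 1 - real j) * cos (real j * jackson_angle d)"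
proof -
  have N: "real d + 2 \<noteq> 0" by linarith
  then have "(real d + 2) * (1 - (real j + 1) / (real d + 2)) = real d + 1 - real j"
    by (simp add: right_diff_distrib)
  with N show ?thesis
    unfolding jackson_damping_def distrib_left mult.assoc[symmetric] by simp
qed

lemma jackson_damping_1: "jackson_damping 1 d = cos (jackson_angle d)"
proof -
  define x where "x = jackson_angle d"
  have "sin (2 * x) / sin x = 2 * cos x"
    using sin_jackson_angle_pos[of d] by (simp add: sin_double x_def)
  then have "(real d + 2) * jackson_damping 1 d = (real d + 2) * cos x"
    using jackson_damping_mult[of d 1] by (simp add: algebra_simps x_def)
  then show ?thesis by (simp add: x_def)
qed

text \<open>In this form the terms without denominator complete the square
  \<open>2 * (1 - cos x)\<^sup>2\<close> in \<open>integral_jackson_kernel_sin4\<close>; the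
  fourth-order square and the remaining fraction give the cubic decay there.\<close>

lemma jackson_damping_2:
  "jackson_damping 2 d = 1 - 2 * (sin (jackson_angle d))\<^sup>2 + 2 * (sin (jackson_angle d))\<^sup>2 / (real d + 2)"
    (is "_ = ?r")
proof -
  define x where "x = jackson_angle d"
  have c: "(cos x)\<^sup>2 = 1 - (sin x)\<^sup>2" by (simp add: cos_squared_eq)
  have c2: "cos (2 * x) = 1 - 2 * (sin x)\<^sup>2" by (simp add: cos_double_sin)
  have "sin (3 * x) = sin (2 * x + x)" by simp
  also have "\<dots> = sin x * (2 * (cos x)\<^sup>2 + cos (2 * x))"
    unfolding sin_add sin_double by (simp add: power2_eq_square algebra_simps)
  also have "\<dots> = sin x * (3 - 4 * (sin x)\<^sup>2)" unfolding c c2 by (simp add: algebra_simps)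
  finally have "sin (3 * x) / sin x = 3 - 4 * (sin x)\<^sup>2"
    using sin_jackson_angle_pos[of d] by (simp add: x_def)
  then have "(real d + 2) * jackson_damping 2 d = 3 - 4 * (sin x)\<^sup>2 + (real d - 1) * (1 - 2 * (sin x)\<^sup>2)"
    using jackson_damping_mult[of d 2] c2 by (simp add: x_def add.commute)
  also have "\<dots> = (real d + 2) * (1 - 2 * (sin x)\<^sup>2) + 2 * (sin x)\<^sup>2"
    by (simp add: algebra_simps)
  also have "\<dots> = (real d + 2) * ?r"
    unfolding x_def distrib_left by simp
  finally show ?thesis by simp
qed

text \<open>Product-to-sum splits each summand into a part constant in \<open>k\<close> and a cosine
  whose argument grows by \<open>2 * x\<close>; multiplied by \<open>2 * sin x\<close>, these
  cosines telescope.\<close>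

lemma sum_sin_mult_sin_shift:
  fixes x :: real
  shows "4 * sin x * (\<Sum>k<m. sin ((real k + 1) * x) * sin ((real k + 1 + real j) * x))
     = 2 * real m * sin x * cos (real j * x) - sin ((2 * real m + 1 + real j) * x) + sin ((1 + real j) * x)"
proof (induction m)
  case (Suc m)
  let ?a = "(real m + 1) * x" and ?b = "(real m + 1 + real j) * x"
  have "2 * sin ?a * sin ?b = cos (?b - ?a) - cos (?b + ?a)"
    by (simp only: cos_diff cos_add) algebra
  moreover have "2 * sin x * cos (?b + ?a) = sin (?b + ?a + x) - sin (?b + ?a - x)"
    by (simp only: sin_diff sin_add) algebra
  ultimately have "4 * sin x * (sin ?a * sin ?b)
      = 2 * sin x * cos (?b - ?a) - sin (?b + ?a + x) + sin (?b + ?a - x)"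
    by algebra
  moreover have "?b - ?a = real j * x" "?b + ?a + x = (2 * real (Suc m) + 1 + real j) * x"
    "?b + ?a - x = (2 * real m + 1 + real j) * x" by (simp_all add: algebra_simps)
  ultimately have "4 * sin x * (sin ?a * sin ?b) = 2 * sin x * cos (real j * x)
      - sin ((2 * real (Suc m) + 1 + real j) * x) + sin ((2 * real m + 1 + real j) * x)" by simp
  with Suc show ?case by (simp add: distrib_left) (simp add: algebra_simps)
qed simp

lemma jackson_damping_autocorrelation:
  assumes "j \<le> d"
  shows "(real d + 2) * jackson_damping j d / 2
    = (\<Sum>k<Suc d - j. sin ((real k + 1) * jackson_angle d) * sin ((real k + 1 + real j) * jackson_angle d))"
proof -
  define x where "x = jackson_angle d"
  define S where "S = (\<Sum>k<Suc d - j. sin ((real k + 1) * x) * sin ((real k + 1 + real j) * x))"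
  have s: "sin x > 0" unfolding x_def by (rule sin_jackson_angle_pos)
  have m: "real (Suc d - j) = real d + 1 - real j" using assms by (simp add: of_nat_diff)
  \<comment> \<open>Here \<open>2 * (d + 1 - j) + 1 + j = 2 * (d + 2) - (1 + j)\<close>, and
    \<open>d + 2\<close> angles make \<open>pi\<close>. So the upper boundary term folds back onto
    the lower one, and the two add up instead of cancelling.\<close>
  have "(2 * real (Suc d - j) + 1 + real j) * x = 2 * pi - (1 + real j) * x"
    unfolding m x_def jackson_angle_def by (simp add: field_simps)
  then have "sin ((2 * real (Suc d - j) + 1 + real j) * x) = - sin ((1 + real j) * x)"
    by (simp add: sin_diff)
  with sum_sin_mult_sin_shift[where x = x and m = "Suc d - j" and j = j]
  have S: "4 * sin x * S = 2 * (real d + 1 - real j) * sin x * cos (real j * x) + 2 * sin ((1 + real j) * x)"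
    unfolding S_def m by simp
  have "4 * sin x * ((real d + 2) * jackson_damping j d / 2)
      = 2 * sin ((1 + real j) * x) + 2 * (real d + 1 - real j) * sin x * cos (real j * x)"
    unfolding jackson_damping_mult x_def[symmetric] using s by (simp add: field_simps)
  with S have "4 * sin x * ((real d + 2) * jackson_damping j d / 2) = 4 * sin x * S" by simp
  then have "(real d + 2) * jackson_damping j d / 2 = S" using s by (simp add: mult.commute)
  then show ?thesis unfolding S_def x_def .
qed

section \<open>The Jackson kernel and its nonnegativity\<close>

text \<open>The left side is the squared modulus of the sum of \<open>c k\<close> times exp(i k u),
  in real form. Passing to \<open>Suc n\<close> adds one square and cross terms, and the latter
  supply the last summand of every autocorrelation.\<close>

lemma trig_poly_norm_square:
  fixes c :: "nat \<Rightarrow> real"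
  shows "(\<Sum>k<Suc n. c k * cos (real k * u))\<^sup>2 + (\<Sum>k<Suc n. c k * sin (real k * u))\<^sup>2
    = (\<Sum>k<Suc n. (c k)\<^sup>2) + 2 * (\<Sum>j=1..n. cos (real j * u) * (\<Sum>k<Suc n - j. c k * c (k + j)))"
proof (induction n)
  case 0
  then show ?case by (simp add: power_mult_distrib flip: distrib_left)
next
  case (Suc n)
  let ?C = "\<Sum>k<Suc n. c k * cos (real k * u)" and ?S = "\<Sum>k<Suc n. c k * sin (real k * u)"
  let ?e = "c (Suc n)" and ?v = "real (Suc n) * u"
  have lhs: "(\<Sum>k<Suc (Suc n). c k * cos (real k * u))\<^sup>2 + (\<Sum>k<Suc (Suc n). c k * sin (real k * u))\<^sup>2
    = ?C\<^sup>2 + ?S\<^sup>2 + ?e\<^sup>2 * ((cos ?v)\<^sup>2 + (sin ?v)\<^sup>2) + 2 * ?e * (?C * cos ?v + ?S * sin ?v)"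
    unfolding sum.lessThan_Suc[of _ "Suc n"] by (simp only: power2_eq_square) algebra
  have "?C * cos ?v + ?S * sin ?v = (\<Sum>k<Suc n. c k * cos (?v - real k * u))"
    unfolding sum_distrib_right sum.distrib[symmetric]
    by (rule sum.cong) (simp_all only: cos_diff, simp add: algebra_simps)
  also have "\<dots> = (\<Sum>j=1..Suc n. c (Suc n - j) * cos (real j * u))"
    by (rule sum.reindex_bij_witness[of _ "\<lambda>j. Suc n - j" "\<lambda>k. Suc n - k"])
       (auto simp: of_nat_diff algebra_simps)
  finally have *: "?C * cos ?v + ?S * sin ?v = (\<Sum>j=1..Suc n. c (Suc n - j) * cos (real j * u))" .
  have cross: "?e * (?C * cos ?v + ?S * sin ?v)
      = (\<Sum>j=1..Suc n. cos (real j * u) * (c (Suc n - j) * ?e))"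
    unfolding * sum_distrib_left by (rule sum.cong) simp_all
  have "(\<Sum>j=1..Suc n. cos (real j * u) * (\<Sum>k<Suc (Suc n) - j. c k * c (k + j)))
    = (\<Sum>j=1..Suc n. cos (real j * u) * (\<Sum>k<Suc n - j. c k * c (k + j))
         + cos (real j * u) * (c (Suc n - j) * ?e))"
  proof (rule sum.cong)
    fix j assume "j \<in> {1..Suc n}"
    then have "Suc (Suc n) - j = Suc (Suc n - j)" "Suc n - j + j = Suc n" by auto
    then show "cos (real j * u) * (\<Sum>k<Suc (Suc n) - j. c k * c (k + j))
      = cos (real j * u) * (\<Sum>k<Suc n - j. c k * c (k + j)) + cos (real j * u) * (c (Suc n - j) * ?e)"
      by (simp add: distrib_left)
  qed simp
  \<comment> \<open>For lag \<open>j = Suc n\<close> the old inner range is empty, so the outer sum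
    may stop at \<open>n\<close>, as in the induction hypothesis.\<close>
  also have "\<dots> = (\<Sum>j=1..n. cos (real j * u) * (\<Sum>k<Suc n - j. c k * c (k + j)))
      + ?e * (?C * cos ?v + ?S * sin ?v)"
    unfolding cross sum.distrib by simp
  finally show ?case
    unfolding lhs Suc.IH sum.lessThan_Suc[of "\<lambda>k. (c k)\<^sup>2" "Suc n"] by simp
qed

definition jackson_kernel :: "nat \<Rightarrow> real \<Rightarrow> real" where
  "jackson_kernel d u = 1 / 2 + (\<Sum>j=1..d. jackson_damping j d * cos (real j * u))"

text \<open>By the autocorrelation formula, \<open>(d + 2) * jackson_kernel d u\<close> is the
  squared modulus of the trigonometric polynomial with coefficients \<open>c k\<close>.\<close>

lemma jackson_kernel_nonneg: "jackson_kernel d u \<ge> 0"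
proof -
  define c where "c k = sin ((real k + 1) * jackson_angle d)" for k
  have r: "(\<Sum>k<Suc d - j. c k * c (k + j)) = (real d + 2) * jackson_damping j d / 2" if "j \<le> d" for j
    using jackson_damping_autocorrelation[OF that] by (simp add: c_def add_ac)
  \<comment> \<open>Lag 0 fixes the scale: it identifies the sum of squares with the constant term
    of \<open>(d + 2) * jackson_kernel d u\<close>.\<close>
  have "jackson_damping 0 d = 1"
    using sin_jackson_angle_pos[of d] by (simp add: jackson_damping_def)
  with r[of 0] have r0: "(\<Sum>k<Suc d. (c k)\<^sup>2) = (real d + 2) / 2" by (simp add: power2_eq_square)
  have "(\<Sum>j=1..d. cos (real j * u) * (\<Sum>k<Suc d - j. c k * c (k + j)))
      = (\<Sum>j=1..d. (real d + 2) / 2 * (jackson_damping j d * cos (real j * u)))"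
    by (rule sum.cong) (auto simp: r)
  then have "(real d + 2) * jackson_kernel d u = (\<Sum>k<Suc d. (c k)\<^sup>2)
      + 2 * (\<Sum>j=1..d. cos (real j * u) * (\<Sum>k<Suc d - j. c k * c (k + j)))"
    unfolding r0 by (simp add: jackson_kernel_def distrib_left sum_distrib_left)
  also have "\<dots> \<ge> 0" unfolding trig_poly_norm_square[symmetric] by simp
  finally show ?thesis by (simp add: zero_le_mult_iff)
qed

lemma jackson_kernel_minus: "jackson_kernel d (- u) = jackson_kernel d u"
  by (simp add: jackson_kernel_def)

lemma continuous_on_jackson_kernel [continuous_intros]:
  fixes f :: "real \<Rightarrow> real"
  shows "continuous_on S f \<Longrightarrow> continuous_on S (\<lambda>x. jackson_kernel d (f x))"
  unfolding jackson_kernel_def by (intro continuous_intros)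

section \<open>Orthogonality and moments of the kernel\<close>

text \<open>\<open>L\<close> counts half-periods; it is 1 or 2 later, because the mirrored argument
  can run past \<open>pi\<close>. The frequency is an integer to admit the difference
  \<open>j - m\<close>.\<close>

lemma has_integral_cos_int_mult:
  fixes k :: int
  shows "((\<lambda>u. cos (of_int k * u)) has_integral (if k = 0 then real L * pi else 0)) {0..real L * pi}"
proof (cases "k = 0")
  case True
  then show ?thesis using has_integral_const_real[of "1::real" 0 "real L * pi"] by simp
next
  case False
  have "((\<lambda>u. cos (of_int k * u)) has_integral
      sin (of_int k * (real L * pi)) / of_int k - sin (of_int k * 0) / of_int k) {0..real L * pi}"
    by (rule fundamental_theorem_of_calculus)
       (use False in \<open>auto intro!: derivative_eq_intros simp flip: has_real_derivative_iff_has_vector_derivative\<close>)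
  moreover have "sin (of_int k * (real L * pi)) = 0"
    using sin_npi_int[of "k * int L"] by (simp add: mult_ac)
  ultimately show ?thesis using False by simp
qed

lemma has_integral_cos_mult_cos:
  "((\<lambda>u. cos (real j * u) * cos (real m * u)) has_integral
     (if j = m then if j = 0 then real L * pi else real L * pi / 2 else 0)) {0..real L * pi}"
proof -
  let ?I = "\<lambda>k::int. if k = 0 then real L * pi else 0"
  have "((\<lambda>u. (cos (of_int (int j - int m) * u) + cos (of_int (int j + int m) * u)) / 2) has_integral
      (?I (int j - int m) + ?I (int j + int m)) / 2) {0..real L * pi}"
    by (intro has_integral_divide has_integral_add has_integral_cos_int_mult)
  moreover have "(cos (of_int (int j - int m) * u) + cos (of_int (int j + int m) * u)) / 2
      = cos (real j * u) * cos (real m * u)" for u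
    by (simp add: algebra_simps cos_add cos_diff)
  moreover have "(?I (int j - int m) + ?I (int j + int m)) / 2
      = (if j = m then if j = 0 then real L * pi else real L * pi / 2 else 0)" by auto
  ultimately show ?thesis by simp
qed

text \<open>Orthogonality reads off one coefficient. For \<open>m = 0\<close> the halved constant
  term of the kernel offsets the doubled integral of the constant function, so one prefactor serves
  both cases.\<close>

lemma has_integral_jackson_kernel_cos:
  assumes "m \<le> d"
  shows "((\<lambda>u. jackson_kernel d u * cos (real m * u)) has_integral
     real L * pi / 2 * (if m = 0 then 1 else jackson_damping m d)) {0..real L * pi}"
proof -
  let ?I = "\<lambda>j. if j = m then if j = 0 then real L * pi else real L * pi / 2 else 0"
  have "((\<lambda>u. 1 / 2 * (cos (real 0 * u) * cos (real m * u))
        + (\<Sum>j=1..d. jackson_damping j d * (cos (real j * u) * cos (real m * u)))) has_integral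
      1 / 2 * ?I 0 + (\<Sum>j=1..d. jackson_damping j d * ?I j)) {0..real L * pi}"
    by (intro has_integral_add has_integral_mult_right has_integral_sum has_integral_cos_mult_cos finite_atLeastAtMost)
  moreover have "1 / 2 * (cos (real 0 * u) * cos (real m * u))
        + (\<Sum>j=1..d. jackson_damping j d * (cos (real j * u) * cos (real m * u)))
      = jackson_kernel d u * cos (real m * u)" for u
    by (simp add: jackson_kernel_def distrib_right sum_distrib_right mult.assoc)
  moreover have "(\<Sum>j=1..d. jackson_damping j d * ?I j)
      = (\<Sum>j=1..d. if j = m then jackson_damping m d * (real L * pi / 2) else 0)"
    by (rule sum.cong) auto
  moreover have "1 / 2 * ?I 0 + (\<Sum>j=1..d. if j = m then jackson_damping m d * (real L * pi / 2) else 0)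
      = real L * pi / 2 * (if m = 0 then 1 else jackson_damping m d)"
    using assms by (simp add: sum.delta)
  ultimately show ?thesis by (simp only:)
qed

lemma one_minus_cos_jackson_angle: "1 - cos (jackson_angle d) \<le> pi\<^sup>2 / (2 * (real d + 2)\<^sup>2)"
proof -
  have "1 - cos (jackson_angle d) = 2 * (sin (jackson_angle d / 2))\<^sup>2"
    using cos_double_sin[of "jackson_angle d / 2"] by simp
  also have "\<dots> \<le> 2 * (jackson_angle d / 2)\<^sup>2"
    by (intro mult_left_mono) (use abs_le_square_iff abs_sin_x_le_abs_x in \<open>blast, simp\<close>)
  also have "\<dots> = (jackson_angle d)\<^sup>2 / 2" by (simp add: power_divide)
  finally show ?thesis unfolding jackson_angle_def power_divide by simp
qed

lemma has_integral_jackson_kernel_sin2: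
  assumes "d \<ge> 1"
  shows "((\<lambda>u. jackson_kernel d u * (sin (u / 2))\<^sup>2) has_integral
     real L * pi / 4 * (1 - cos (jackson_angle d))) {0..real L * pi}"
proof -
  have s2: "(sin (u / 2))\<^sup>2 = (1 - cos u) / 2" for u :: real
    using cos_double_sin[of "u / 2"] by simp
  have "((\<lambda>u. 1 / 2 * (jackson_kernel d u * cos (real 0 * u)) - 1 / 2 * (jackson_kernel d u * cos (real 1 * u)))
      has_integral 1 / 2 * (real L * pi / 2 * 1) - 1 / 2 * (real L * pi / 2 * jackson_damping 1 d)) {0..real L * pi}"
    using has_integral_jackson_kernel_cos[of 0 d L] has_integral_jackson_kernel_cos[of 1 d L] assms
    by (intro has_integral_diff has_integral_mult_right) auto
  moreover have "1 / 2 * (jackson_kernel d u * cos (real 0 * u)) - 1 / 2 * (jackson_kernel d u * cos (real 1 * u))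
      = jackson_kernel d u * (sin (u / 2))\<^sup>2" for u
    by (simp add: s2 right_diff_distrib)
  moreover have "1 / 2 * (real L * pi / 2 * 1) - 1 / 2 * (real L * pi / 2 * jackson_damping 1 d)
      = real L * pi / 4 * (1 - cos (jackson_angle d))"
    by (simp add: jackson_damping_1[simplified] right_diff_distrib)
  ultimately show ?thesis by (simp only:)
qed

lemma integral_jackson_kernel_sin4:
  assumes "d \<ge> 2"
  shows "integral {0..real L * pi} (\<lambda>u. jackson_kernel d u * (sin (u / 2))^4)
     \<le> real L * (pi ^ 3 / (4 * (real d + 2) ^ 3))"
proof -
  define x where "x = jackson_angle d"
  define N where "N = real d + 2"
  have N: "N \<ge> 4" using assms by (simp add: N_def)
  \<comment> \<open>The weights are the Fourier coefficients of the fourth power of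
    \<open>sin (u / 2)\<close>, checked in the next step.\<close>
  have "((\<lambda>u. 3 / 8 * (jackson_kernel d u * cos (real 0 * u)) - 1 / 2 * (jackson_kernel d u * cos (real 1 * u))
        + 1 / 8 * (jackson_kernel d u * cos (real 2 * u)))
      has_integral 3 / 8 * (real L * pi / 2 * 1) - 1 / 2 * (real L * pi / 2 * jackson_damping 1 d)
        + 1 / 8 * (real L * pi / 2 * jackson_damping 2 d)) {0..real L * pi}"
    using has_integral_jackson_kernel_cos[of 0 d L] has_integral_jackson_kernel_cos[of 1 d L]
      has_integral_jackson_kernel_cos[of 2 d L] assms
    by (intro has_integral_diff has_integral_add has_integral_mult_right) auto
  moreover have "3 / 8 * (jackson_kernel d u * cos (real 0 * u)) - 1 / 2 * (jackson_kernel d u * cos (real 1 * u))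
        + 1 / 8 * (jackson_kernel d u * cos (real 2 * u)) = jackson_kernel d u * (sin (u / 2))^4" for u
  proof -
    have s2: "(sin (u / 2))\<^sup>2 = (1 - cos u) / 2" using cos_double_sin[of "u / 2"] by simp
    have "(sin (u / 2))^4 = ((1 - cos u) / 2)\<^sup>2"
      using power_mult[of "sin (u / 2)" 2 2] by (simp only: num_double s2, simp)
    also have "\<dots> = (1 - 2 * cos u + (cos u)\<^sup>2) / 4" by (simp add: power_divide power2_diff)
    also have "\<dots> = 3 / 8 - 1 / 2 * cos u + 1 / 8 * cos (2 * u)"
      using cos_double_cos[of u] by (simp add: field_simps)
    finally show ?thesis by (simp add: distrib_left right_diff_distrib)
  qed
  ultimately have I: "integral {0..real L * pi} (\<lambda>u. jackson_kernel d u * (sin (u / 2))^4)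
      = real L * pi / 16 * (3 - 4 * cos x + jackson_damping 2 d)"
    by (simp add: integral_unique jackson_damping_1[simplified] x_def algebra_simps)
  have c: "(sin x)\<^sup>2 = 1 - (cos x)\<^sup>2" by (simp add: sin_squared_eq)
  have "3 - 4 * cos x + jackson_damping 2 d = 4 - 4 * cos x - 2 * (sin x)\<^sup>2 + 2 * (sin x)\<^sup>2 / N"
    by (simp add: jackson_damping_2 x_def N_def)
  also have "\<dots> = 2 * (1 - cos x)\<^sup>2 + 2 * (sin x)\<^sup>2 / N"
    using c by (simp add: power2_diff)
  also have "\<dots> \<le> 2 * (pi\<^sup>2 / (2 * N\<^sup>2))\<^sup>2 + 2 * (pi / N)\<^sup>2 / N"
  proof -
    have "(1 - cos x)\<^sup>2 \<le> (pi\<^sup>2 / (2 * N\<^sup>2))\<^sup>2"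
      using one_minus_cos_jackson_angle[of d] by (intro power_mono) (auto simp: x_def N_def)
    moreover have "(sin x)\<^sup>2 \<le> (pi / N)\<^sup>2"
      using abs_sin_x_le_abs_x[of x] unfolding abs_le_square_iff by (simp add: x_def N_def jackson_angle_def)
    ultimately show ?thesis using N by (intro add_mono divide_right_mono mult_left_mono) auto
  qed
  also have "\<dots> = pi\<^sup>2 / N^3 * (pi\<^sup>2 / (2 * N) + 2)"
    using N by (simp add: field_simps power2_eq_square power3_eq_cube)
  \<comment> \<open>From \<open>pi < 4\<close> and \<open>N \<ge> 4\<close>, the fraction in the
    bracket is at most 2.\<close>
  also have "\<dots> \<le> pi\<^sup>2 / N^3 * 4"
  proof -
    have "pi\<^sup>2 \<le> 4\<^sup>2" using pi_less_4 by (intro power_mono) auto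
    then have "pi\<^sup>2 / (2 * N) + 2 \<le> 4" using N by (simp add: field_simps)
    then show ?thesis using N by (intro mult_left_mono) auto
  qed
  finally have "real L * pi / 16 * (3 - 4 * cos x + jackson_damping 2 d) \<le> real L * pi / 16 * (pi\<^sup>2 / N^3 * 4)"
    by (intro mult_left_mono) auto
  then show ?thesis unfolding I N_def[symmetric] by (simp add: power2_eq_square power3_eq_cube)
qed

section \<open>First moment and far mass\<close>

text \<open>A concave function lies above its chord; here the chord rises from 0 at 0 to 1 at
  \<open>pi\<close>.\<close>

lemma le_pi_mult_sin_half:
  fixes x :: real
  assumes "0 \<le> x" "x \<le> pi"
  shows "x \<le> pi * sin (x / 2)"
proof -
  have "concave_on {0..pi} (\<lambda>x. sin (x / 2))"
    by (rule f''_le0_imp_concave[where f' = "\<lambda>x. cos (x / 2) / 2" and f'' = "\<lambda>x. - sin (x / 2) / 4"])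
       (auto intro!: derivative_eq_intros sin_ge_zero)
  from concave_onD[OF this, of "x / pi" 0 pi] assms
  have "x / pi \<le> sin (x / 2)" by (simp add: field_simps)
  then show ?thesis by (simp add: field_simps)
qed

text \<open>A pointwise form of Cauchy-Schwarz: \<open>u\<close> is majorised by a constant plus a
  multiple of \<open>(sin (u / 2))\<^sup>2\<close>, and both have known integrals against the
  kernel.\<close>

lemma integral_mult_jackson_kernel_le:
  assumes "d \<ge> 1"
  shows "integral {0..pi} (\<lambda>u. u * jackson_kernel d u) \<le> pi ^ 3 / (4 * (real d + 2))"
proof -
  define N where "N = real d + 2"
  have N: "N > 0" by (simp add: N_def)
  have I: "((\<lambda>u. pi\<^sup>2 / (4 * N) * (jackson_kernel d u * cos (real 0 * u))
      + N * (jackson_kernel d u * (sin (u / 2))\<^sup>2)) has_integral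
      pi\<^sup>2 / (4 * N) * (real 1 * pi / 2 * 1) + N * (real 1 * pi / 4 * (1 - cos (jackson_angle d)))) {0..real 1 * pi}"
    using has_integral_jackson_kernel_cos[of 0 d 1] has_integral_jackson_kernel_sin2[of d 1] assms
    by (intro has_integral_add has_integral_mult_right) auto
  have "integral {0..pi} (\<lambda>u. u * jackson_kernel d u)
      \<le> integral {0..pi} (\<lambda>u. pi\<^sup>2 / (4 * N) * (jackson_kernel d u * cos (real 0 * u))
        + N * (jackson_kernel d u * (sin (u / 2))\<^sup>2))"
  proof (rule integral_le)
    fix u :: real assume u: "u \<in> {0..pi}"
    let ?s = "sin (u / 2)"
    \<comment> \<open>AM-GM, balanced so that both terms contribute equally to the final bound\<close>
    have "0 \<le> N * (pi / (2 * N) - ?s)\<^sup>2" using N by simp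
    also have "\<dots> = pi\<^sup>2 / (4 * N) + N * ?s\<^sup>2 - pi * ?s"
      using N by (simp add: power2_eq_square field_simps)
    finally have "u \<le> pi\<^sup>2 / (4 * N) + N * ?s\<^sup>2" using le_pi_mult_sin_half[of u] u by simp
    from mult_right_mono[OF this jackson_kernel_nonneg[of d u]]
    show "u * jackson_kernel d u \<le> pi\<^sup>2 / (4 * N) * (jackson_kernel d u * cos (real 0 * u))
        + N * (jackson_kernel d u * ?s\<^sup>2)" by (simp add: algebra_simps)
  qed (use I N in \<open>auto intro!: integrable_continuous_real continuous_intros\<close>)
  also have "\<dots> = pi ^ 3 / (8 * N) + N * (pi / 4) * (1 - cos (jackson_angle d))"
    using integral_unique[OF I] by (simp add: power2_eq_square power3_eq_cube)
  \<comment> \<open>The second summand is now \<open>pi ^ 3 / (8 * N)\<close> as well.\<close>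
  also have "\<dots> \<le> pi ^ 3 / (8 * N) + N * (pi / 4) * (pi\<^sup>2 / (2 * N\<^sup>2))"
    using one_minus_cos_jackson_angle[of d] N by (intro add_left_mono mult_left_mono) (auto simp: N_def)
  also have "\<dots> = pi ^ 3 / (4 * N)"
    using N by (simp add: field_simps power2_eq_square power3_eq_cube)
  finally show ?thesis unfolding N_def .
qed

text \<open>Markov's inequality with the fourth power of \<open>sin (v / 2)\<close>: at distance at
  least \<open>\<delta>\<close> from 0 and \<open>2 * pi\<close> this sine is at least
  \<open>\<delta> / pi\<close>.\<close>

lemma integral_jackson_kernel_far_le:
  assumes d: "d \<ge> 2" and \<delta>: "0 < \<delta>" "\<delta> \<le> pi" and sub: "{l..u} \<subseteq> {0..real L * pi}"
    and far: "{l..u} \<subseteq> {\<delta>..2 * pi - \<delta>}"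
  shows "integral {l..u} (jackson_kernel d) \<le> real L * ((pi / \<delta>) ^ 4 * (pi ^ 3 / (4 * (real d + 2) ^ 3)))"
proof -
  let ?f = "\<lambda>u. (pi / \<delta>) ^ 4 * (jackson_kernel d u * (sin (u / 2)) ^ 4)"
  have "integral {l..u} (jackson_kernel d) \<le> integral {l..u} ?f"
  proof (rule integral_le)
    fix v assume "v \<in> {l..u}"
    with far have v: "\<delta> \<le> v" "v \<le> 2 * pi - \<delta>" by auto
    have "sin (\<delta> / 2) \<le> sin (v / 2)"
    proof (cases "v \<le> pi")
      case True
      then show ?thesis using v \<delta> by (intro sin_monotone_2pi_le) auto
    next
      case False
      \<comment> \<open>Past \<open>pi\<close> the sine of \<open>v / 2\<close> decreases, so
        \<open>v\<close> is reflected about \<open>pi\<close>.\<close>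
      have "sin (\<delta> / 2) \<le> sin (pi - v / 2)" using v \<delta> False by (intro sin_monotone_2pi_le) auto
      then show ?thesis by simp
    qed
    then have "\<delta> \<le> pi * sin (v / 2)"
      using le_pi_mult_sin_half[of \<delta>] \<delta> by (smt (verit) mult_left_mono pi_gt_zero)
    then have "1 \<le> pi / \<delta> * sin (v / 2)" using \<delta> by (simp add: field_simps)
    then have "1 \<le> (pi / \<delta>) ^ 4 * (sin (v / 2)) ^ 4"
      by (metis one_le_power power_mult_distrib)
    from mult_right_mono[OF this jackson_kernel_nonneg[of d v]]
    show "jackson_kernel d v \<le> ?f v" by (simp add: mult_ac)
  qed (use \<delta> in \<open>auto intro!: integrable_continuous_real continuous_intros\<close>)
  \<comment> \<open>The integrand is nonnegative, so the domain may grow to whole half-periods,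
    where the moment is known.\<close>
  also have "\<dots> \<le> integral {0..real L * pi} ?f"
    by (rule integral_subset_le[OF sub])
       (use \<delta> in \<open>auto intro!: integrable_continuous_real continuous_intros mult_nonneg_nonneg jackson_kernel_nonneg\<close>)
  also have "\<dots> = (pi / \<delta>) ^ 4 * integral {0..real L * pi} (\<lambda>u. jackson_kernel d u * (sin (u / 2)) ^ 4)"
    by simp
  also have "\<dots> \<le> (pi / \<delta>) ^ 4 * (real L * (pi ^ 3 / (4 * (real d + 2) ^ 3)))"
    by (intro mult_left_mono integral_jackson_kernel_sin4 d) simp
  finally show ?thesis by (simp add: mult_ac)
qed

section \<open>Error of the smoothed integral at an endpoint\<close>

lemma integral_jackson_kernel: "integral {0..pi} (jackson_kernel d) = pi / 2"
  using has_integral_jackson_kernel_cos[of 0 d 1] by (simp add: integral_unique)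

text \<open>Evenness makes the two endpoints interchangeable, so one argument covers both
  \<open>c = l\<close> and \<open>c = u\<close>.\<close>

lemma integral_shift_to_endpoint:
  fixes f :: "real \<Rightarrow> real"
  assumes "continuous_on UNIV f" "\<And>x. f (- x) = f x" "c = l \<or> c = u"
  shows "integral {l..u} (\<lambda>x. f (x - c)) = integral {0..u - l} f"
proof -
  have *: "integral {l..u} (\<lambda>x. f (x - c)) = integral {l - c..u - c} f"
    using integral_shift[of l "- c" u f] assms(1) continuous_on_subset by (fastforce simp: o_def)
  show ?thesis
  proof (cases "c = l")
    case False
    then have "c = u" using assms(3) by simp
    have "integral {l - u..0} f = integral {l - u..0} (\<lambda>x. f (- x))" using assms(2) by simp
    also have "\<dots> = integral {0..u - l} f" using Henstock_Kurzweil_Integration.integral_reflect_real[of "u - l" 0 f] by simp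
    finally show ?thesis using * \<open>c = u\<close> by simp
  qed (use * in simp)
qed

text \<open>\<open>S\<close> bounds the function and \<open>D\<close> is a Lipschitz constant
  relative to \<open>c\<close>. The condition on \<open>{l + c..u + c}\<close> keeps the mirrored
  argument away from 0 and \<open>2 * pi\<close>, where the kernel concentrates.\<close>

lemma jackson_integral_error_le:
  fixes f :: "real \<Rightarrow> real"
  assumes d: "d \<ge> 2" and lu: "l < u" "0 \<le> l" "u \<le> pi" and c: "c = l \<or> c = u"
    and \<delta>: "0 < \<delta>" "\<delta> \<le> u - l" "{l + c..u + c} \<subseteq> {\<delta>..2 * pi - \<delta>}"
    and f: "continuous_on {l..u} f" "\<And>x. x \<in> {l..u} \<Longrightarrow> \<bar>f x\<bar> \<le> S"
      "\<And>x. x \<in> {l..u} \<Longrightarrow> \<bar>f x - f c\<bar> \<le> D * \<bar>x - c\<bar>"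
  shows "\<bar>integral {l..u} (\<lambda>x. f x * (jackson_kernel d (x - c) + jackson_kernel d (x + c))) / pi - f c / 2\<bar>
    \<le> 3 * pi ^ 6 * S / (4 * \<delta> ^ 4 * (real d + 2) ^ 3) + pi\<^sup>2 * D / (4 * (real d + 2))"
proof -
  let ?K = "jackson_kernel d"
  \<comment> \<open>The bound on the far mass per half-period.\<close>
  define B where "B = (pi / \<delta>) ^ 4 * (pi ^ 3 / (4 * (real d + 2) ^ 3))"
  have cont: "continuous_on X ?K" for X
    using continuous_on_jackson_kernel[OF continuous_on_id] by simp
  note int = integrable_continuous_real continuous_intros f(1)
  have D: "D \<ge> 0"
  proof -
    \<comment> \<open>The witness \<open>l + u - c\<close> is the opposite endpoint; the Lipschitz
      hypothesis there forces \<open>D\<close> to be nonnegative.\<close>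
    have "\<exists>x\<in>{l..u}. \<bar>x - c\<bar> > 0" using c lu by (intro bexI[of _ "l + u - c"]) auto
    then obtain x where "x \<in> {l..u}" "\<bar>x - c\<bar> > 0" by blast
    then show ?thesis using f(3)[of x] by (smt (verit) mult_neg_pos)
  qed
  have "c \<in> {l..u}" using c lu by auto
  with f(2) have fc: "\<bar>f c\<bar> \<le> S" by blast
  then have S: "S \<ge> 0" by linarith
  have near: "\<bar>integral {l..u} (\<lambda>x. (f x - f c) * ?K (x - c))\<bar> \<le> D * (pi ^ 3 / (4 * (real d + 2)))"
  proof -
    have "norm (integral {l..u} (\<lambda>x. (f x - f c) * ?K (x - c)))
        \<le> integral {l..u} (\<lambda>x. D * (\<bar>x - c\<bar> * ?K (x - c)))"
    proof (rule integral_norm_bound_integral)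
      fix x assume "x \<in> {l..u}"
      from mult_right_mono[OF f(3)[OF this] jackson_kernel_nonneg[of d "x - c"]]
      show "norm ((f x - f c) * ?K (x - c)) \<le> D * (\<bar>x - c\<bar> * ?K (x - c))"
        by (simp add: abs_mult jackson_kernel_nonneg mult_ac)
    qed (auto intro!: int)
    also have "\<dots> = D * integral {0..u - l} (\<lambda>x. \<bar>x\<bar> * ?K x)"
      using integral_shift_to_endpoint[of "\<lambda>x. \<bar>x\<bar> * ?K x" c l u] c
      by (simp add: jackson_kernel_minus continuous_on_mult continuous_on_rabs continuous_on_id cont)
    also have "integral {0..u - l} (\<lambda>x. \<bar>x\<bar> * ?K x) \<le> integral {0..pi} (\<lambda>x. \<bar>x\<bar> * ?K x)"
      by (rule integral_subset_le) (use lu in \<open>auto intro!: int mult_nonneg_nonneg jackson_kernel_nonneg\<close>)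
    also have "\<dots> = integral {0..pi} (\<lambda>x. x * ?K x)"
      by (rule Henstock_Kurzweil_Integration.integral_cong) auto
    also have "\<dots> \<le> pi ^ 3 / (4 * (real d + 2))" using d by (intro integral_mult_jackson_kernel_le) auto
    finally show ?thesis using D by (simp add: mult_left_mono)
  qed
  have mass: "\<bar>integral {l..u} (\<lambda>x. ?K (x - c)) - pi / 2\<bar> \<le> B"
  proof -
    have "integral {l..u} (\<lambda>x. ?K (x - c)) = integral {0..u - l} ?K"
      by (rule integral_shift_to_endpoint) (use c cont jackson_kernel_minus in auto)
    moreover have "integral {0..u - l} ?K + integral {u - l..pi} ?K = pi / 2"
      unfolding integral_jackson_kernel[of d, symmetric]
      by (rule Henstock_Kurzweil_Integration.integral_combine) (use lu cont in \<open>auto intro!: integrable_continuous_real\<close>)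
    \<comment> \<open>The tail is far: \<open>\<delta> \<le> u - l \<le> pi\<close> also gives
      \<open>pi \<le> 2 * pi - \<delta>\<close>.\<close>
    moreover have "integral {u - l..pi} ?K \<le> B"
      using integral_jackson_kernel_far_le[of d \<delta> "u - l" pi 1] d \<delta> lu by (auto simp: B_def)
    moreover have "integral {u - l..pi} ?K \<ge> 0"
      by (rule integral_nonneg) (use cont jackson_kernel_nonneg in \<open>auto intro!: integrable_continuous_real\<close>)
    ultimately show ?thesis by linarith
  qed
  have mirror: "\<bar>integral {l..u} (\<lambda>x. f x * ?K (x + c))\<bar> \<le> S * (2 * B)"
  proof -
    have "norm (integral {l..u} (\<lambda>x. f x * ?K (x + c))) \<le> integral {l..u} (\<lambda>x. S * ?K (x + c))"
    proof (rule integral_norm_bound_integral)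
      fix x assume "x \<in> {l..u}"
      from mult_right_mono[OF f(2)[OF this] jackson_kernel_nonneg[of d "x + c"]]
      show "norm (f x * ?K (x + c)) \<le> S * ?K (x + c)"
        by (simp add: abs_mult jackson_kernel_nonneg)
    qed (auto intro!: int)
    also have "\<dots> = S * integral {l + c..u + c} ?K"
      using integral_shift[of l c u ?K] cont by (simp add: o_def)
    \<comment> \<open>The sum of two angles from \<open>[0, pi]\<close> may cover two half-periods,
      hence \<open>L = 2\<close>.\<close>
    also have "integral {l + c..u + c} ?K \<le> 2 * B"
      using integral_jackson_kernel_far_le[of d \<delta> "l + c" "u + c" 2] d \<delta> lu by (auto simp: B_def)
    finally show ?thesis using S by (simp add: mult_left_mono)
  qed
  have "integral {l..u} (\<lambda>x. f x * (?K (x - c) + ?K (x + c)))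
      = integral {l..u} (\<lambda>x. (f x - f c) * ?K (x - c) + f c * ?K (x - c) + f x * ?K (x + c))"
    by (simp add: algebra_simps)
  also have "\<dots> = integral {l..u} (\<lambda>x. (f x - f c) * ?K (x - c))
      + f c * integral {l..u} (\<lambda>x. ?K (x - c)) + integral {l..u} (\<lambda>x. f x * ?K (x + c))"
    by (subst Henstock_Kurzweil_Integration.integral_add, (auto intro!: int)[2])+ simp
  finally have "integral {l..u} (\<lambda>x. f x * (?K (x - c) + ?K (x + c))) - pi * (f c / 2)
      = integral {l..u} (\<lambda>x. (f x - f c) * ?K (x - c))
      + f c * (integral {l..u} (\<lambda>x. ?K (x - c)) - pi / 2) + integral {l..u} (\<lambda>x. f x * ?K (x + c))"
    by (simp add: algebra_simps)
  moreover have "\<bar>f c * (integral {l..u} (\<lambda>x. ?K (x - c)) - pi / 2)\<bar> \<le> S * B"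
    unfolding abs_mult using fc mass S by (intro mult_mono) auto
  ultimately have "\<bar>integral {l..u} (\<lambda>x. f x * (?K (x - c) + ?K (x + c))) - pi * (f c / 2)\<bar>
      \<le> 3 * (S * B) + D * (pi ^ 3 / (4 * (real d + 2)))"
    using near mirror by linarith
  then have "\<bar>integral {l..u} (\<lambda>x. f x * (?K (x - c) + ?K (x + c))) - pi * (f c / 2)\<bar> / pi
      \<le> (3 * (S * B) + D * (pi ^ 3 / (4 * (real d + 2)))) / pi"
    by (rule divide_right_mono) simp
  \<comment> \<open>In \<open>B\<close> the powers \<open>pi ^ 4\<close> and \<open>pi ^ 3\<close>
    multiply; the division removes one factor \<open>pi\<close>.\<close>
  also have "\<dots> = 3 * pi ^ 6 * S / (4 * \<delta> ^ 4 * (real d + 2) ^ 3) + pi\<^sup>2 * D / (4 * (real d + 2))"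
    using \<delta> by (simp add: B_def add_divide_distrib power_divide numeral_eq_Suc mult_ac)
  finally have *: "\<bar>integral {l..u} (\<lambda>x. f x * (?K (x - c) + ?K (x + c))) - pi * (f c / 2)\<bar> / pi \<le> \<dots>" .
  have "integral {l..u} (\<lambda>x. f x * (?K (x - c) + ?K (x + c))) / pi - f c / 2
      = (integral {l..u} (\<lambda>x. f x * (?K (x - c) + ?K (x + c))) - pi * (f c / 2)) / pi"
    by (simp add: diff_divide_distrib)
  then show ?thesis using * by (simp only: abs_divide) simp
qed

section \<open>Integral representation of the expansion\<close>

text \<open>The substitution \<open>t = cos \<theta>\<close>, carried out through
  \<open>arccos\<close>, whose derivative is finite on all of \<open>{a..b}\<close> because the
  interval stays away from -1 and 1.\<close>

lemma cheb_coeff_eq_integral_cos: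
  assumes "-1 < a" "a < b" "b < 1"
  shows "cheb_coeff a b p j = 2 / pi * integral {arccos b..arccos a} (\<lambda>\<theta>. poly p (cos \<theta>) * cos (real j * \<theta>))"
proof -
  let ?f = "\<lambda>\<theta>. poly p (cos \<theta>) * cos (real j * \<theta>)"
  have lt: "arccos b < arccos a" using assms by (intro arccos_less_arccos) auto
  \<comment> \<open>\<open>arccos\<close> is decreasing, so the first of the two oriented integrals
    is over an empty interval and only the negated one survives.\<close>
  have "((\<lambda>t. inverse (- sqrt (1 - t\<^sup>2)) *\<^sub>R ?f (arccos t)) has_integral
      (integral {arccos a..arccos b} ?f - integral {arccos b..arccos a} ?f)) {a..b}"
  proof (rule has_integral_substitution_general[where s = "{}" and c = 0 and d = pi])
    show "arccos ` {a..b} \<subseteq> {0..pi}" using assms by (auto intro!: arccos_lbound arccos_ubound)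
    fix t assume "t \<in> {a..b} - {}"
    then have "-1 < t" "t < 1" using assms by auto
    then show "(arccos has_real_derivative inverse (- sqrt (1 - t\<^sup>2))) (at t within {a..b})"
      by (rule DERIV_subset[OF DERIV_arccos]) simp
  qed (use assms in \<open>auto intro!: continuous_intros\<close>)
  from has_integral_neg[OF this]
  have "((\<lambda>t. - (inverse (- sqrt (1 - t\<^sup>2)) *\<^sub>R ?f (arccos t))) has_integral
      integral {arccos b..arccos a} ?f) {a..b}"
    using lt by (simp only: atLeastatMost_empty integral_empty) simp
  also have "?this \<longleftrightarrow> ((\<lambda>t. poly p t * poly (cheb_poly j) t / sqrt (1 - t\<^sup>2)) has_integral
      integral {arccos b..arccos a} ?f) {a..b}"
  proof (rule has_integral_cong)
    fix t assume "t \<in> {a..b}"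
    then have "cos (arccos t) = t" using assms by simp
    then show "- (inverse (- sqrt (1 - t\<^sup>2)) *\<^sub>R ?f (arccos t)) = poly p t * poly (cheb_poly j) t / sqrt (1 - t\<^sup>2)"
      using poly_cheb_poly_cos[of j "arccos t"] by (simp add: divide_inverse mult_ac)
  qed
  finally show ?thesis unfolding cheb_coeff_def by (simp add: integral_unique)
qed

text \<open>Product-to-sum on \<open>cos (real j * \<phi>) * cos (real j * \<theta>)\<close>
  produces the two shifted kernels; their constants \<open>1 / 2\<close> add up to the weight 1 of
  the term for index 0.\<close>

lemma q_fun_eq_integral_jackson_kernel:
  assumes "-1 < a" "a < b" "b < 1"
  shows "q_fun a b d p \<phi> = integral {arccos b..arccos a}
    (\<lambda>\<theta>. poly p (cos \<theta>) * (jackson_kernel d (\<theta> - \<phi>) + jackson_kernel d (\<theta> + \<phi>))) / pi"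
proof -
  let ?I = "{arccos b..arccos a}"
  have I: "((\<lambda>\<theta>. poly p (cos \<theta>) * cos (real j * \<theta>)) has_integral pi / 2 * cheb_coeff a b p j) ?I" for j
    unfolding cheb_coeff_eq_integral_cos[OF assms]
    by (simp, intro integrable_integral integrable_continuous_real continuous_intros)
  have "((\<lambda>\<theta>. poly p (cos \<theta>) * cos (real 0 * \<theta>)
      + (\<Sum>j=1..d. 2 * jackson_damping j d * cos (real j * \<phi>) * (poly p (cos \<theta>) * cos (real j * \<theta>))))
    has_integral pi / 2 * cheb_coeff a b p 0
      + (\<Sum>j=1..d. 2 * jackson_damping j d * cos (real j * \<phi>) * (pi / 2 * cheb_coeff a b p j))) ?I"
    by (intro has_integral_add has_integral_sum has_integral_mult_right I finite_atLeastAtMost)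
  also have "pi / 2 * cheb_coeff a b p 0
      + (\<Sum>j=1..d. 2 * jackson_damping j d * cos (real j * \<phi>) * (pi / 2 * cheb_coeff a b p j))
      = pi * q_fun a b d p \<phi>"
    unfolding q_fun_eq by (simp add: distrib_left sum_distrib_left mult_ac)
  also have "(\<lambda>\<theta>. poly p (cos \<theta>) * cos (real 0 * \<theta>)
      + (\<Sum>j=1..d. 2 * jackson_damping j d * cos (real j * \<phi>) * (poly p (cos \<theta>) * cos (real j * \<theta>))))
    = (\<lambda>\<theta>. poly p (cos \<theta>) * (jackson_kernel d (\<theta> - \<phi>) + jackson_kernel d (\<theta> + \<phi>)))"
  proof
    fix \<theta> :: real
    have "2 * cos (real j * \<phi>) * cos (real j * \<theta>) = cos (real j * (\<theta> - \<phi>)) + cos (real j * (\<theta> + \<phi>))" for j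
      by (simp add: right_diff_distrib distrib_left cos_diff cos_add)
    then have "jackson_kernel d (\<theta> - \<phi>) + jackson_kernel d (\<theta> + \<phi>)
        = 1 + (\<Sum>j=1..d. jackson_damping j d * (2 * cos (real j * \<phi>) * cos (real j * \<theta>)))"
      by (simp add: jackson_kernel_def distrib_left sum.distrib)
    then show "poly p (cos \<theta>) * cos (real 0 * \<theta>)
      + (\<Sum>j=1..d. 2 * jackson_damping j d * cos (real j * \<phi>) * (poly p (cos \<theta>) * cos (real j * \<theta>)))
      = poly p (cos \<theta>) * (jackson_kernel d (\<theta> - \<phi>) + jackson_kernel d (\<theta> + \<phi>))"
      by (simp add: distrib_left sum_distrib_left mult_ac)
  qed
  finally show ?thesis by (simp add: integral_unique)
qed

section \<open>Supremum norms of \<open>g_fun\<close> and of its derivative\<close>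

lemma abs_le_sup_norm:
  assumes "bdd_above ((\<lambda>x. \<bar>f x\<bar>) ` {l<..<u})" "x \<in> {l<..<u}"
  shows "\<bar>f x\<bar> \<le> sup_norm l u f"
  unfolding sup_norm_def using assms by (intro cSUP_upper) auto

lemma g_fun_eq_poly_cos:
  assumes "-1 < a" "a < b" "b < 1" "\<theta> \<in> {arccos b<..<arccos a}"
  shows "g_fun a b p \<theta> = poly p (cos \<theta>)"
proof -
  have pi: "0 \<le> arccos b" "arccos a \<le> pi" using assms by (auto intro: arccos_lbound arccos_ubound)
  have "cos (arccos a) < cos \<theta>" "cos \<theta> < cos (arccos b)"
    using assms(4) pi by (auto intro!: cos_monotone_0_pi)
  then show ?thesis using assms by (simp add: g_fun_def windowed_poly_def window_def)
qed

text \<open>At the endpoints \<open>g_fun\<close> takes only half the value of the polynomial, so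
  the bound there comes by continuity from the open interval.\<close>

lemma abs_poly_cos_le_sup_norm:
  assumes "-1 < a" "a < b" "b < 1" "\<theta> \<in> {arccos b..arccos a}"
  shows "\<bar>poly p (cos \<theta>)\<bar> \<le> sup_norm 0 pi (g_fun a b p)"
proof -
  have lt: "arccos b < arccos a" using assms by (intro arccos_less_arccos) auto
  have pi: "0 \<le> arccos b" "arccos a \<le> pi" using assms by (auto intro: arccos_lbound arccos_ubound)
  have "compact ((\<lambda>t. \<bar>poly p t\<bar>) ` {-1..1})"
    by (intro compact_continuous_image continuous_intros compact_Icc)
  then obtain C where C: "\<And>t. t \<in> {-1..1} \<Longrightarrow> \<bar>poly p t\<bar> \<le> C"
    using bounded_imp_bdd_above[OF compact_imp_bounded] unfolding bdd_above_def by fast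
  have "\<bar>g_fun a b p x\<bar> \<le> C" for x
    using C[of "cos x"] by (auto simp: g_fun_def windowed_poly_def window_def abs_mult)
  then have bdd: "bdd_above ((\<lambda>x. \<bar>g_fun a b p x\<bar>) ` {0<..<pi})" by (intro bdd_aboveI) auto
  have "\<bar>poly p (cos x)\<bar> \<le> sup_norm 0 pi (g_fun a b p)" if "x \<in> {arccos b<..<arccos a}" for x
    using abs_le_sup_norm[OF bdd, of x] g_fun_eq_poly_cos[OF assms(1-3) that] that pi by auto
  moreover have "\<theta> \<in> closure {arccos b<..<arccos a}" using assms(4) lt by simp
  moreover have "continuous_on (closure {arccos b<..<arccos a}) (\<lambda>x. \<bar>poly p (cos x)\<bar>)"
    by (intro continuous_intros)
  ultimately show ?thesis
    using continuous_le_on_closure[where f = "\<lambda>x. \<bar>poly p (cos x)\<bar>"] by blast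
qed

text \<open>\<open>g_fun\<close> can jump at the endpoints, so the mean value theorem is applied to
  the smooth function \<open>poly p (cos \<theta>)\<close>; the intermediate point is interior,
  where the two derivatives agree.\<close>

lemma poly_cos_lipschitz:
  assumes "-1 < a" "a < b" "b < 1" "x \<in> {arccos b..arccos a}" "y \<in> {arccos b..arccos a}"
  shows "\<bar>poly p (cos x) - poly p (cos y)\<bar> \<le> sup_norm (arccos b) (arccos a) (deriv (g_fun a b p)) * \<bar>x - y\<bar>"
proof -
  let ?D = "sup_norm (arccos b) (arccos a) (deriv (g_fun a b p))"
  let ?f' = "\<lambda>\<theta>. poly (pderiv p) (cos \<theta>) * - sin \<theta>"
  have f': "((\<lambda>\<theta>. poly p (cos \<theta>)) has_real_derivative ?f' \<theta>) (at \<theta>)" for \<theta>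
    by (auto intro!: derivative_eq_intros)
  have deriv: "deriv (g_fun a b p) \<theta> = ?f' \<theta>" if "\<theta> \<in> {arccos b<..<arccos a}" for \<theta>
    by (rule DERIV_imp_deriv, rule has_field_derivative_transform_within_open[OF f' open_greaterThanLessThan that])
       (use g_fun_eq_poly_cos[OF assms(1-3)] in simp)
  \<comment> \<open>Boundedness must be established before the real supremum in
    \<open>sup_norm\<close> bounds anything; it is inherited from the closed interval.\<close>
  have "compact ((\<lambda>\<theta>. \<bar>?f' \<theta>\<bar>) ` {arccos b..arccos a})"
    by (intro compact_continuous_image continuous_intros compact_Icc)
  then have "bdd_above ((\<lambda>\<theta>. \<bar>?f' \<theta>\<bar>) ` {arccos b..arccos a})"
    by (intro bounded_imp_bdd_above compact_imp_bounded)
  then have "bdd_above ((\<lambda>\<theta>. \<bar>?f' \<theta>\<bar>) ` {arccos b<..<arccos a})"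
    by (rule bdd_above_mono) auto
  then have bdd: "bdd_above ((\<lambda>\<theta>. \<bar>deriv (g_fun a b p) \<theta>\<bar>) ` {arccos b<..<arccos a})"
    using deriv by (simp cong: image_cong_simp)
  have *: "\<bar>poly p (cos x) - poly p (cos y)\<bar> \<le> ?D * \<bar>x - y\<bar>"
    if xy: "x < y" "arccos b \<le> x" "y \<le> arccos a" for x y
  proof -
    obtain z where z: "x < z" "z < y" "poly p (cos y) - poly p (cos x) = (y - x) * ?f' z"
      using MVT2[OF xy(1), of "\<lambda>\<theta>. poly p (cos \<theta>)" ?f'] f' by blast
    then have "\<bar>?f' z\<bar> \<le> ?D" using abs_le_sup_norm[OF bdd, of z] deriv[of z] xy by auto
    moreover have "\<bar>poly p (cos x) - poly p (cos y)\<bar> = \<bar>y - x\<bar> * \<bar>?f' z\<bar>"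
      unfolding abs_minus_commute[of "poly p (cos x)"] z(3) abs_mult[of "y - x"] ..
    ultimately show ?thesis by (simp add: mult_left_mono abs_minus_commute mult.commute)
  qed
  show ?thesis
    using *[of x y] *[of y x] assms(4,5) by (cases x y rule: linorder_cases) (auto simp: abs_minus_commute)
qed

theorem theorem3p6:
  fixes a b \<alpha> \<beta> :: real and M d :: nat and p :: "real poly"
  assumes "-1 < a" and "a < b" and "b < 1"
    and "M \<ge> 1" and "degree p \<le> M - 1"
    and "d \<ge> 2"
    and "\<alpha> = arccos a" and "\<beta> = arccos b"
  shows "\<bar>q_fun a b d p \<alpha> - g_fun a b p \<alpha>\<bar>
           \<le> 3 * pi ^ 6 * sup_norm 0 pi (g_fun a b p)
                / (4 * (Delta_\<alpha> \<alpha> \<beta>) ^ 4 * (real d + 2) ^ 3)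
             + pi\<^sup>2 * sup_norm \<beta> \<alpha> (deriv (g_fun a b p)) / (4 * (real d + 2))
       \<and> \<bar>q_fun a b d p \<beta> - g_fun a b p \<beta>\<bar>
           \<le> 3 * pi ^ 6 * sup_norm 0 pi (g_fun a b p)
                / (4 * (Delta_\<beta> \<alpha> \<beta>) ^ 4 * (real d + 2) ^ 3)
             + pi\<^sup>2 * sup_norm \<beta> \<alpha> (deriv (g_fun a b p)) / (4 * (real d + 2))"
proof -
  note ab = assms(1-3)
  note \<alpha>\<beta> = assms(7,8)
  have bounds: "\<beta> < \<alpha>" "0 < \<beta>" "\<alpha> < pi"
    using ab arccos_less_arccos[of a b] arccos_less_arccos[of b 1] arccos_less_arccos[of "-1" a]
    by (auto simp: \<alpha>\<beta>)
  have main: "\<bar>q_fun a b d p c - g_fun a b p c\<bar>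
      \<le> 3 * pi ^ 6 * sup_norm 0 pi (g_fun a b p) / (4 * \<delta> ^ 4 * (real d + 2) ^ 3)
        + pi\<^sup>2 * sup_norm \<beta> \<alpha> (deriv (g_fun a b p)) / (4 * (real d + 2))"
    if c: "c = \<beta> \<or> c = \<alpha>" and \<delta>: "0 < \<delta>" "\<delta> \<le> \<alpha> - \<beta>" "{\<beta> + c..\<alpha> + c} \<subseteq> {\<delta>..2 * pi - \<delta>}" for c \<delta>
  proof -
    \<comment> \<open>At either endpoint the window equals \<open>1 / 2\<close>.\<close>
    have "cos c = a \<or> cos c = b" using c ab by (auto simp: \<alpha>\<beta>)
    then have "g_fun a b p c = poly p (cos c) / 2"
      using ab by (auto simp: g_fun_def windowed_poly_def window_def)
    moreover have "c \<in> {arccos b..arccos a}" using c bounds by (auto simp: \<alpha>\<beta>)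
    ultimately show ?thesis
      unfolding q_fun_eq_integral_jackson_kernel[OF ab] \<alpha>\<beta>[symmetric]
      using abs_poly_cos_le_sup_norm[OF ab, folded \<alpha>\<beta>] poly_cos_lipschitz[OF ab, folded \<alpha>\<beta>] bounds
      by (simp only:, intro jackson_integral_error_le c \<delta> assms(6)) (auto intro!: continuous_intros)
  qed
  \<comment> \<open>For \<open>c = \<alpha>\<close> the mirrored range ends at
    \<open>2 * \<alpha>\<close>, which requires \<open>\<delta> \<le> 2 * pi - 2 * \<alpha>\<close>;
    for \<open>c = \<beta>\<close> it starts at \<open>2 * \<beta>\<close>. In both cases
    \<open>\<delta> \<le> \<alpha> - \<beta>\<close> settles the other end.\<close>
  show ?thesis
    by (intro conjI main) (use bounds in \<open>auto simp: Delta_\<alpha>_def Delta_\<beta>_def\<close>)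
qed

end
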